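(* Let $m\geq 5$ be odd. There exists a constant $C_m>0$ (depending only on $m$) such that for all integers $n\ge 1$ $$r_3(\mathbb{Z}_m^n) \geq \frac{C_m}{\sqrt{n}} \left(\frac{m+1}{2}\right)^n.$$ Moreover, with $\sigma_m=\sqrt{\frac{1}{2880}\left(m^4+4m^3-14m^2-36m+45\right)}$, the value $C_m=\frac{1}{3\sqrt{3}\, \sigma_m}$ is admissible. With this choice, as $m\to\infty$ through odd values, $C_m \sim \frac{8 \sqrt{5}}{\sqrt{3}\, m^2}$.
   Context: $\mathbb{Z}_m^n$ denotes the additive group $(\mathbb{Z}/m\mathbb{Z})^n$. A proper arithmetic progression of length $k$ in $\mathbb{Z}_m^n$ is a sequence $x, x+d, \ldots, x+(k-1)d$ (with $x,d\in\mathbb{Z}_m^n$) whose $k$ elements are pairwise distinct. $r_k(\mathbb{Z}_m^n)$ denotes the maximal size of a set $S\subseteq\mathbb{Z}_m^n$ that does not contain a proper arithmetic progression of length $k$. *)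

theory Defs
  imports Complex_Main "HOL-Algebra.Product_Groups" "HOL-Library.Landau_Symbols"
begin

definition cyclic_power_group :: "nat \<Rightarrow> nat \<Rightarrow> (nat \<Rightarrow> int) monoid" where
  "cyclic_power_group m n = product_group {..<n} (\<lambda>_. integer_mod_group m)"

(* HOL-Algebra writes groups multiplicatively: the i-th term below is x + i d. *)
definition ap_term :: "('a, 'b) monoid_scheme \<Rightarrow> 'a \<Rightarrow> 'a \<Rightarrow> nat \<Rightarrow> 'a" where
  "ap_term G x d i = x \<otimes>\<^bsub>G\<^esub> (d [^]\<^bsub>G\<^esub> i)"

definition contains_proper_ap :: "('a, 'b) monoid_scheme \<Rightarrow> nat \<Rightarrow> 'a set \<Rightarrow> bool" where
  "contains_proper_ap G k S \<longleftrightarrow>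
     (\<exists>x\<in>carrier G. \<exists>d\<in>carrier G.
        inj_on (ap_term G x d) {..<k} \<and> ap_term G x d ` {..<k} \<subseteq> S)"

(* For a finite carrier and k > 0 the maximum is over a finite set, nonempty because of S = {}. *)
definition ap_free_max :: "nat \<Rightarrow> ('a, 'b) monoid_scheme \<Rightarrow> nat" where
  "ap_free_max k G = Max {card S |S. S \<subseteq> carrier G \<and> \<not> contains_proper_ap G k S}"

definition sigma_const :: "nat \<Rightarrow> real" where
  "sigma_const m =
     sqrt (1 / 2880 * (real m ^ 4 + 4 * real m ^ 3 - 14 * real m ^ 2 - 36 * real m + 45))"

definition C_const :: "nat \<Rightarrow> real" where
  "C_const m = 1 / (3 * sqrt 3 * sigma_const m)"

definition admissible_const :: "nat \<Rightarrow> real \<Rightarrow> bool" where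
  "admissible_const m C \<longleftrightarrow>
     C > 0 \<and>
     (\<forall>n\<ge>1. real (ap_free_max 3 (cyclic_power_group m n))
               \<ge> C / sqrt (real n) * ((real m + 1) / 2) ^ n)"

end

theory Submission
  imports Defs "HOL-Real_Asymp.Real_Asymp"
begin

text \<open>
  Let \<open>k = (m + 1) / 2\<close> and consider vectors with all digits in \<open>{0..<k}\<close>. Their sums do not wrap
  around modulo \<open>m = 2 k - 1\<close>, so a progression of length 3 among them is a progression of integer
  vectors, and the strictly convex function \<open>T x = (\<Sum>i. (x i)\<^sup>2 - (k - 1) x i)\<close> is not constant on it.
  Hence every level set of \<open>T\<close> is free of proper progressions. On the \<open>k ^ n\<close> vectors \<open>T\<close> is integer-valued
  with variance \<open>V = n \<sigma>\<^sup>2\<close>, and some level set is large because an integer-valued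
  function whose values are not repeated often has large variance. Chebyshev's inequality followed
  by the pigeonhole principle would only give the constant up to rounding of the number of integers
  in a window; keeping the weight \<open>N\<^sup>2 / 4 - (T - \<mu>)\<^sup>2\<close> on a window of \<open>N\<close> integers with \<open>N\<^sup>2\<close> close to
  \<open>12 V\<close> leaves room for the rounding.
\<close>

section \<open>Large level sets of integer-valued functions\<close>

text \<open>Squared mean plus variance: \<open>N\<close> consecutive integers have variance (N^2 -
  1)/12.\<close>

lemma sum_squares_shifted:
  fixes a :: real
  shows "(\<Sum>i<N. (a + real i)\<^sup>2) = real N * (a + (real N - 1) / 2)\<^sup>2 + real N * ((real N)\<^sup>2 - 1) / 12"
  by (induction N) (simp_all add: field_simps power2_eq_square)

text \<open>Both sides bound 12 times the sum of \<open>g (T a)\<close> over \<open>A\<close>. The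
  variance bounds it from below. From above, values outside the window \<open>W\<close> contribute
  nothing positive, and each value inside is taken at most \<open>M\<close> times.\<close>

lemma card_le_fibers_variance:
  fixes T :: "'a \<Rightarrow> int" and \<mu> V M :: real and N :: nat
  assumes fin: "finite A"
    and var: "(\<Sum>a\<in>A. (real_of_int (T a) - \<mu>)\<^sup>2) \<le> real (card A) * V"
    and fib: "\<And>t. real (card {a\<in>A. T a = t}) \<le> M"
  shows "(3 * (real N)\<^sup>2 - 12 * V) * real (card A) \<le> M * (2 * real N ^ 3 + real N)"
proof -
  define R where "R = real N / 2"
  define g where "g j = R\<^sup>2 - (real_of_int j - \<mu>)\<^sup>2" for j
  \<comment> \<open>Rounding up makes the \<open>N\<close> integers from \<open>J\<close> on lie
    within \<open>R\<close> of \<open>\<mu>\<close> and all others at distance at least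
    \<open>R\<close>, so \<open>W\<close> separates the signs of \<open>g\<close>.\<close>
  define J where "J = \<lceil>\<mu> - R\<rceil>"
  define W where "W = (\<lambda>i. J + int i) ` {..<N}"
  have R0: "R \<ge> 0" by (simp add: R_def)
  have J: "real_of_int J \<ge> \<mu> - R" "real_of_int J < \<mu> - R + 1"
    unfolding J_def by linarith+
  have W_iff: "j \<in> W \<longleftrightarrow> J \<le> j \<and> j < J + int N" for j
  proof
    assume "J \<le> j \<and> j < J + int N"
    then show "j \<in> W" unfolding W_def
      by (intro image_eqI[of _ _ "nat (j - J)"]) auto
  qed (auto simp: W_def)
  have finW: "finite W" by (simp add: W_def)
  have inside: "g j \<ge> 0" if "j \<in> W" for j
  proof -
    have "real_of_int j \<ge> real_of_int J" "real_of_int j \<le> real_of_int J + real N - 1"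
      using that unfolding W_iff by linarith+
    then have "\<bar>real_of_int j - \<mu>\<bar> \<le> R" using J unfolding R_def abs_le_iff by linarith
    then show ?thesis unfolding g_def by (metis abs_ge_zero diff_ge_0_iff_ge power2_abs power_mono)
  qed
  have outside: "g j \<le> 0" if "j \<notin> W" for j
  proof -
    have "j \<le> J - 1 \<or> j \<ge> J + int N" using that unfolding W_iff by linarith
    then have "real_of_int j \<le> real_of_int J - 1 \<or> real_of_int j \<ge> real_of_int J + real N"
      by linarith
    then have "\<bar>real_of_int j - \<mu>\<bar> \<ge> R" using J unfolding R_def by linarith
    then show ?thesis unfolding g_def using R0
      by (metis diff_le_0_iff_le power2_abs power_mono)
  qed
  have "real (card A) * R\<^sup>2 - real (card A) * V \<le> (\<Sum>a\<in>A. g (T a))"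
    unfolding g_def sum_subtractf using var by simp
  also have "\<dots> \<le> (\<Sum>a\<in>{a\<in>A. T a \<in> W}. g (T a))"
  proof -
    have "(\<Sum>a\<in>A. g (T a)) = (\<Sum>a\<in>{a\<in>A. T a \<in> W}. g (T a)) + (\<Sum>a\<in>{a\<in>A. T a \<notin> W}. g (T a))"
      by (subst sum.union_disjoint[symmetric]) (auto intro: sum.cong simp: fin)
    moreover have "(\<Sum>a\<in>{a\<in>A. T a \<notin> W}. g (T a)) \<le> 0"
      by (rule sum_nonpos) (auto intro: outside)
    ultimately show ?thesis by linarith
  qed
  also have "\<dots> = (\<Sum>j\<in>W. \<Sum>a\<in>{a\<in>{a\<in>A. T a \<in> W}. T a = j}. g (T a))"
    by (rule sum.group[symmetric]) (auto simp: fin finW)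
  also have "\<dots> = (\<Sum>j\<in>W. real (card {a\<in>A. T a = j}) * g j)"
  proof (rule sum.cong)
    fix j assume "j \<in> W"
    then have "{a\<in>{a\<in>A. T a \<in> W}. T a = j} = {a\<in>A. T a = j}" by auto
    then show "(\<Sum>a\<in>{a\<in>{a\<in>A. T a \<in> W}. T a = j}. g (T a)) = real (card {a\<in>A. T a = j}) * g j"
      by simp
  qed simp
  also have "\<dots> \<le> (\<Sum>j\<in>W. M * g j)"
    by (intro sum_mono mult_right_mono fib inside)
  also have "\<dots> = M * (\<Sum>j\<in>W. g j)" by (simp add: sum_distrib_left)
  also have "(\<Sum>j\<in>W. g j) = (\<Sum>i<N. R\<^sup>2 - ((real_of_int J - \<mu>) + real i)\<^sup>2)"
    unfolding W_def by (subst sum.reindex) (auto simp: inj_on_def g_def algebra_simps)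
  also have "\<dots> = real N * R\<^sup>2 - real N * ((real_of_int J - \<mu>) + (real N - 1) / 2)\<^sup>2
                  - real N * ((real N)\<^sup>2 - 1) / 12"
    by (simp add: sum_subtractf sum_squares_shifted)
  \<comment> \<open>The dropped square measures how far the window is off centre.\<close>
  also have "M * \<dots> \<le> M * (real N * R\<^sup>2 - real N * ((real N)\<^sup>2 - 1) / 12)"
  proof (rule mult_left_mono)
    show "0 \<le> M" using fib[of 0] by (meson of_nat_0_le_iff order_trans)
  qed simp
  finally show ?thesis
    by (simp add: R_def field_simps power2_eq_square power3_eq_cube)
qed

text \<open>A window of length \<open>w = sqrt (12 * V)\<close> would give roughly
  \<open>card A / w\<close>. The claim is 2/3 of that, since 27 = (9/4) * 12; the slack pays for
  rounding \<open>w\<close> up to \<open>N\<close> and for the lower-order term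
  \<open>real N\<close>.\<close>

lemma ex_large_fiber:
  fixes T :: "'a \<Rightarrow> int" and \<mu> V :: real
  assumes fin: "finite A"
    and var: "(\<Sum>a\<in>A. (real_of_int (T a) - \<mu>)\<^sup>2) \<le> real (card A) * V"
    and V: "V \<ge> 2 / 9"
  shows "\<exists>t. real (card {a\<in>A. T a = t}) \<ge> real (card A) / sqrt (27 * V)"
proof (cases "A = {}")
  case False
  define c where "c t = card {a\<in>A. T a = t}" for t
  have ne: "finite (c ` T ` A)" "c ` T ` A \<noteq> {}" using fin False by auto
  obtain t where t: "c t = Max (c ` T ` A)" using Max_in[OF ne] by (metis imageE)
  have "c s \<le> c t" for s
  proof (cases "s \<in> T ` A")
    case True
    then show ?thesis unfolding t using ne by (intro Max_ge) auto
  next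
    case False
    then have "{a\<in>A. T a = s} = {}" by auto
    then show ?thesis unfolding c_def by (metis card.empty zero_le)
  qed
  then have fib: "real (card {a\<in>A. T a = s}) \<le> real (c t)" for s
    unfolding c_def by simp
  define w where "w = sqrt (12 * V)"
  define N where "N = nat \<lceil>w\<rceil>"
  define s where "s = real N - w"
  have w2: "w\<^sup>2 = 12 * V" unfolding w_def using V by simp
  \<comment> \<open>\<open>V \<ge> 2 / 9\<close> gives w^2 >= 8/3 > 1.6^2.\<close>
  have w16: "w \<ge> 1.6"
    unfolding w_def using V by (intro real_le_rsqrt) (simp add: power2_eq_square)
  have N: "real N = w + s" by (simp add: s_def)
  have s: "0 \<le> s" "s \<le> 1" unfolding s_def N_def using w16 by linarith+
  \<comment> \<open>With N = w + s, right minus left is 2w(w^2 - 1) + s(6w^2 - 3ws - 4s^2 - 2); both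
    summands are nonnegative.\<close>
  have "2 * (2 * real N ^ 3 + real N) \<le> 3 * w * (3 * (real N)\<^sup>2 - w\<^sup>2)"
  proof -
    have w2': "w * w \<ge> 1.6 * w" using w16 by (intro mult_right_mono) auto
    have "w * w - 1 \<ge> 0" using w16 w2' by linarith
    then have "w * (w * w - 1) \<ge> 0" using w16 by (intro mult_nonneg_nonneg) auto
    moreover have "s * (6 * (w * w) - 3 * (w * s) - 4 * (s * s) - 2) \<ge> 0"
    proof (intro mult_nonneg_nonneg s)
      have "w * s \<le> w * 1" using s w16 by (intro mult_left_mono) auto
      moreover have "s * s \<le> 1 * 1" using s by (intro mult_mono) auto
      ultimately show "6 * (w * w) - 3 * (w * s) - 4 * (s * s) - 2 \<ge> 0"
        using w2' w16 by linarith
    qed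
    ultimately show ?thesis
      unfolding N by (simp add: power2_eq_square power3_eq_cube algebra_simps)
  qed
  then have "2 * (2 * real N ^ 3 + real N) * real (card A)
      \<le> 3 * w * (3 * (real N)\<^sup>2 - w\<^sup>2) * real (card A)"
    by (intro mult_right_mono) auto
  also have "\<dots> = 3 * w * ((3 * (real N)\<^sup>2 - 12 * V) * real (card A))" by (simp add: w2)
  also have "\<dots> \<le> 3 * w * (real (c t) * (2 * real N ^ 3 + real N))"
    using w16 by (intro mult_left_mono card_le_fibers_variance[OF fin var fib]) auto
  finally have "(2 * real N ^ 3 + real N) * (2 * real (card A))
      \<le> (2 * real N ^ 3 + real N) * (3 * w * real (c t))"
    by (simp add: algebra_simps)
  moreover have "2 * real N ^ 3 + real N > 0" using N s w16 by (simp add: add_nonneg_pos)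
  ultimately have A_le: "2 * real (card A) \<le> 3 * w * real (c t)"
    by (simp only: mult_le_cancel_left_pos)
  have sqrt_V: "sqrt (27 * V) = 3 * w / 2"
  proof (rule real_sqrt_unique)
    show "(3 * w / 2)\<^sup>2 = 27 * V" by (simp add: power_divide power_mult_distrib w2)
  qed (use w16 in auto)
  have "real (card A) / sqrt (27 * V) \<le> real (c t)"
    unfolding sqrt_V using w16 A_le by (simp add: field_simps)
  then show ?thesis unfolding c_def by blast
qed simp

section \<open>The variance of the quadratic form\<close>

lemma sum_PiE_insert:
  assumes "i \<notin> I"
  shows "(\<Sum>x\<in>PiE (insert i I) D. h x) = (\<Sum>v\<in>D i. \<Sum>y\<in>PiE I D. h (y(i := v)))"
proof -
  have "(\<Sum>x\<in>PiE (insert i I) D. h x) = (\<Sum>(v, y)\<in>D i \<times> PiE I D. h (y(i := v)))"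
    unfolding PiE_insert_eq
    by (subst sum.reindex[OF inj_combinator[OF assms]]) (simp add: case_prod_unfold)
  then show ?thesis by (simp add: sum.cartesian_product)
qed

lemma sum_PiE_sum_centered:
  fixes f :: "'b \<Rightarrow> real"
  assumes "finite I" and "(\<Sum>v\<in>D. f v) = 0"
  shows "(\<Sum>x\<in>PiE I (\<lambda>_. D). \<Sum>i\<in>I. f (x i)) = 0"
  using assms(1)
proof induction
  case (insert j I)
  have eq: "(\<Sum>i\<in>I. f (if i = j then v else y i)) = (\<Sum>i\<in>I. f (y i))" for v y
    using insert by (intro sum.cong) auto
  have "(\<Sum>x\<in>PiE (insert j I) (\<lambda>_. D). \<Sum>i\<in>insert j I. f (x i))
      = (\<Sum>v\<in>D. \<Sum>y\<in>PiE I (\<lambda>_. D). f v + (\<Sum>i\<in>I. f (y i)))"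
    using insert by (simp add: sum_PiE_insert eq)
  also have "\<dots> = 0"
    using insert.IH assms(2) by (simp add: sum.distrib sum_distrib_left[symmetric])
  finally show ?case .
qed simp

text \<open>Variances of independent coordinates add up: expanding the square, the cross terms
  vanish because \<open>f\<close> is centred.\<close>

lemma sum_PiE_sum_squared:
  fixes f :: "'b \<Rightarrow> real"
  assumes "finite I" and "(\<Sum>v\<in>D. f v) = 0" and "(\<Sum>v\<in>D. (f v)\<^sup>2) = real (card D) * s"
  shows "(\<Sum>x\<in>PiE I (\<lambda>_. D). (\<Sum>i\<in>I. f (x i))\<^sup>2) = real (card D) ^ card I * (real (card I) * s)"
  using assms(1)
proof induction
  case (insert j I)
  have eq: "(\<Sum>i\<in>I. f (if i = j then v else y i)) = (\<Sum>i\<in>I. f (y i))" for v y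
    using insert by (intro sum.cong) auto
  let ?F = "\<lambda>y. \<Sum>i\<in>I. f (y i)"
  let ?P = "PiE I (\<lambda>_. D)"
  have card: "real (card ?P) = real (card D) ^ card I"
    using insert by (simp add: card_PiE)
  have "(\<Sum>x\<in>PiE (insert j I) (\<lambda>_. D). (\<Sum>i\<in>insert j I. f (x i))\<^sup>2)
      = (\<Sum>v\<in>D. \<Sum>y\<in>?P. (f v + ?F y)\<^sup>2)"
    using insert by (simp add: sum_PiE_insert eq)
  also have "\<dots> = (\<Sum>v\<in>D. real (card ?P) * (f v)\<^sup>2 + (\<Sum>y\<in>?P. (?F y)\<^sup>2) + 2 * f v * (\<Sum>y\<in>?P. ?F y))"
    by (simp add: power2_sum sum.distrib sum_distrib_left)
  also have "\<dots> = real (card ?P) * (real (card D) * s) + real (card D) * (\<Sum>y\<in>?P. (?F y)\<^sup>2)"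
    using sum_PiE_sum_centered[OF insert.hyps(1) assms(2)]
    by (simp add: sum.distrib assms(3) sum_distrib_left[symmetric])
  also have "\<dots> = real (card D) ^ card (insert j I) * (real (card (insert j I)) * s)"
    using insert by (simp add: card algebra_simps)
  finally show ?case .
qed simp

lemma sum_quadratic:
  fixes c \<nu> :: real
  shows "(\<Sum>x<j. real x ^ 2 - c * real x - \<nu>)
    = real j * (real j - 1) * (2 * real j - 1) / 6 - c * (real j * (real j - 1) / 2) - real j * \<nu>"
  by (induction j) (simp_all add: field_simps power2_eq_square)

text \<open>\<open>c\<close> and \<open>\<nu>\<close> are kept free because the induction on
  \<open>j\<close> must fix them, whereas the application takes values depending on the upper
  limit.\<close>

lemma sum_quadratic_squared:
  fixes c \<nu> :: real
  shows "(\<Sum>x<j. (real x ^ 2 - c * real x - \<nu>)\<^sup>2)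
    = real j * (real j - 1) * (2 * real j - 1) * (3 * real j ^ 2 - 3 * real j - 1) / 30
      - 2 * c * (real j * (real j - 1) / 2) ^ 2
      + (c\<^sup>2 - 2 * \<nu>) * (real j * (real j - 1) * (2 * real j - 1) / 6)
      + 2 * c * \<nu> * (real j * (real j - 1) / 2) + real j * \<nu>\<^sup>2"
  by (induction j) (simp_all add: field_simps power2_eq_square)

text \<open>The linear term leaves second differences unchanged but moves the vertex to the midpoint
  (k - 1)/2 of the digits. This makes the variance smaller than that of v^2, and the values stay
  integers.\<close>

definition digit_form :: "nat \<Rightarrow> int \<Rightarrow> int" where
  "digit_form k v = v\<^sup>2 - (int k - 1) * v"

definition digit_mean :: "nat \<Rightarrow> real" where
  "digit_mean k = - (real k - 1) * (real k - 2) / 6"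

lemma sum_digits:
  fixes h :: "int \<Rightarrow> real"
  shows "(\<Sum>v\<in>{0..<int k}. h v) = (\<Sum>x<k. h (int x))"
  by (rule sum.reindex_bij_witness[of _ int nat]) auto

lemma digit_form_centered:
  "(\<Sum>v\<in>{0..<int k}. real_of_int (digit_form k v) - digit_mean k) = 0"
proof -
  have "(\<Sum>v\<in>{0..<int k}. real_of_int (digit_form k v) - digit_mean k)
      = (\<Sum>x<k. real x ^ 2 - (real k - 1) * real x - digit_mean k)"
    unfolding sum_digits by (simp add: digit_form_def)
  also have "\<dots> = 0"
    unfolding sum_quadratic digit_mean_def by (simp add: field_simps)
  finally show ?thesis .
qed

lemma digit_form_variance:
  "(\<Sum>v\<in>{0..<int k}. (real_of_int (digit_form k v) - digit_mean k)\<^sup>2)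
    = real k * (((real k)\<^sup>2 - 1) * ((real k)\<^sup>2 - 4) / 180)"
proof -
  have "(\<Sum>v\<in>{0..<int k}. (real_of_int (digit_form k v) - digit_mean k)\<^sup>2)
      = (\<Sum>x<k. (real x ^ 2 - (real k - 1) * real x - digit_mean k)\<^sup>2)"
    unfolding sum_digits by (simp add: digit_form_def)
  also have "\<dots> = real k * (((real k)\<^sup>2 - 1) * ((real k)\<^sup>2 - 4) / 180)"
    unfolding sum_quadratic_squared digit_mean_def
    by (simp add: field_simps power2_eq_square)
  finally show ?thesis .
qed

text \<open>At m = 2k - 1 the quartic factors as 16 (k^2 - 1)(k^2 - 4). The bound 2/9 is its value
  at k = 3 divided by 2880.\<close>

lemma sigma_const_squared:
  assumes "m = 2 * k - 1" "k \<ge> 3"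
  shows "(sigma_const m)\<^sup>2 = ((real k)\<^sup>2 - 1) * ((real k)\<^sup>2 - 4) / 180" (is "_ = ?v")
    and "(sigma_const m)\<^sup>2 \<ge> 2 / 9"
    and "sigma_const m > 0"
proof -
  have m: "real m = 2 * real k - 1" using assms by simp
  have "1 / 2880 * (real m ^ 4 + 4 * real m ^ 3 - 14 * real m ^ 2 - 36 * real m + 45) = ?v"
    unfolding m by (simp add: field_simps power2_eq_square power3_eq_cube power4_eq_xxxx)
  then have s: "sigma_const m = sqrt ?v" unfolding sigma_const_def by simp
  have "(real k)\<^sup>2 \<ge> 3\<^sup>2" using assms by (intro power_mono) auto
  then have "((real k)\<^sup>2 - 1) * ((real k)\<^sup>2 - 4) \<ge> 8 * 5" by (intro mult_mono) auto
  then have v: "?v \<ge> 2 / 9" by simp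
  then show "(sigma_const m)\<^sup>2 = ?v" "(sigma_const m)\<^sup>2 \<ge> 2 / 9" "sigma_const m > 0"
    unfolding s by auto
qed

section \<open>Progressions in the cyclic power groups\<close>

lemma carrier_cyclic_power_group:
  "m > 0 \<Longrightarrow> carrier (cyclic_power_group m n) = PiE {..<n} (\<lambda>_. {0..<int m})"
  by (simp add: cyclic_power_group_def carrier_integer_mod_group)

lemma mult_cyclic_power_group:
  "x \<otimes>\<^bsub>cyclic_power_group m n\<^esub> y = (\<lambda>i\<in>{..<n}. (x i + y i) mod int m)"
  by (simp add: cyclic_power_group_def mult_integer_mod_group)

lemma group_cyclic_power_group: "group (cyclic_power_group m n)"
  by (simp add: cyclic_power_group_def)

lemma ap_term_rec:
  assumes "group G" "x \<in> carrier G" "d \<in> carrier G"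
  shows "ap_term G x d 0 = x"
    and "ap_term G x d (Suc i) = ap_term G x d i \<otimes>\<^bsub>G\<^esub> d"
proof -
  interpret group G by fact
  show "ap_term G x d 0 = x" "ap_term G x d (Suc i) = ap_term G x d i \<otimes>\<^bsub>G\<^esub> d"
    using assms by (simp_all add: ap_term_def m_assoc)
qed

lemma level_set_ap_free:
  assumes m: "m = 2 * k - 1" and k: "k > 0"
  shows "\<not> contains_proper_ap (cyclic_power_group m n) 3
           {x \<in> PiE {..<n} (\<lambda>_. {0..<int k}). (\<Sum>i<n. digit_form k (x i)) = t}"
    (is "\<not> contains_proper_ap ?G 3 ?S")
proof
  assume "contains_proper_ap ?G 3 ?S"
  then obtain x d where x: "x \<in> carrier ?G" and d: "d \<in> carrier ?G"
    and inj: "inj_on (ap_term ?G x d) {..<3}" and sub: "ap_term ?G x d ` {..<3} \<subseteq> ?S"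
    unfolding contains_proper_ap_def by blast
  define y where "y = x \<otimes>\<^bsub>?G\<^esub> d"
  define z where "z = y \<otimes>\<^bsub>?G\<^esub> d"
  note rec = ap_term_rec[OF group_cyclic_power_group x d]
  have terms: "ap_term ?G x d 0 = x" "ap_term ?G x d 1 = y" "ap_term ?G x d 2 = z"
    by (simp_all add: rec y_def z_def numeral_2_eq_2)
  have inS: "ap_term ?G x d i \<in> ?S" if "i < 3" for i using sub that by blast
  have xS: "x \<in> ?S" and yS: "y \<in> ?S" and zS: "z \<in> ?S"
    using inS[of 0] inS[of 1] inS[of 2] unfolding terms by simp_all
  have mid: "x i + z i = 2 * y i" if "i < n" for i
  proof -
    have y: "y i = (x i + d i) mod int m" and z: "z i = (y i + d i) mod int m"
      using that by (simp_all add: y_def z_def mult_cyclic_power_group)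
    have r: "0 \<le> x i" "x i < int k" "0 \<le> y i" "y i < int k" "0 \<le> z i" "z i < int k"
      using xS yS zS that by (auto simp: PiE_iff)
    have "int m dvd (x i + d i) - y i" unfolding y by (rule dvd_minus_mod)
    moreover have "int m dvd (y i + d i) - z i" unfolding z by (rule dvd_minus_mod)
    \<comment> \<open>Subtracting the two congruences cancels \<open>d i\<close>.\<close>
    ultimately have "int m dvd ((x i + d i) - y i) - ((y i + d i) - z i)" by (rule dvd_diff)
    moreover have "((x i + d i) - y i) - ((y i + d i) - z i) = x i + z i - 2 * y i" by simp
    \<comment> \<open>Both \<open>x i + z i\<close> and \<open>2 * y i\<close> lie between 0 and 2k
      - 2 = m - 1, so the multiple of \<open>m\<close> must be 0.\<close>
    moreover have "\<bar>x i + z i - 2 * y i\<bar> < int m" using r m k by linarith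
    ultimately show ?thesis
      using dvd_imp_le_int[of "x i + z i - 2 * y i" "int m"] by fastforce
  qed
  have form: "digit_form k (x i) + digit_form k (z i) - 2 * digit_form k (y i) = 2 * (y i - x i)\<^sup>2"
    if "i < n" for i
  proof -
    have z: "z i = 2 * y i - x i" using mid[OF that] by simp
    show ?thesis unfolding z digit_form_def by (simp add: power2_eq_square algebra_simps)
  qed
  \<comment> \<open>All three terms lie on level \<open>t\<close>, so the second differences sum to
    t + t - 2t = 0 and every square vanishes.\<close>
  have "(\<Sum>i<n. 2 * (y i - x i)\<^sup>2)
      = (\<Sum>i<n. digit_form k (x i) + digit_form k (z i) - 2 * digit_form k (y i))"
    by (intro sum.cong) (simp_all add: form)
  also have "\<dots> = 0"
    using xS yS zS by (simp add: sum.distrib sum_subtractf sum_distrib_left[symmetric])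
  finally have "\<forall>i<n. y i = x i"
    by (subst (asm) sum_nonneg_eq_0_iff) auto
  then have "x = y"
    using xS yS by (intro PiE_ext[of x "{..<n}" "\<lambda>_. {0..<int k}" y]) auto
  then have "ap_term ?G x d 0 = ap_term ?G x d 1" using terms by metis
  then show False using inj_onD[OF inj] by force
qed

lemma card_le_ap_free_max:
  assumes "finite (carrier G)" "S \<subseteq> carrier G" "\<not> contains_proper_ap G k S"
  shows "card S \<le> ap_free_max k G"
proof -
  have "finite {card S |S. S \<subseteq> carrier G \<and> \<not> contains_proper_ap G k S}"
    by (rule finite_subset[of _ "card ` Pow (carrier G)"]) (use assms(1) in auto)
  then show ?thesis unfolding ap_free_max_def using assms by (intro Max_ge) auto
qed

section \<open>The lower bound and the asymptotics of its constant\<close>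

lemma admissible_C_const:
  assumes "m \<ge> 5" "odd m"
  shows "admissible_const m (C_const m)"
proof -
  define k where "k = (m + 1) div 2"
  have m: "m = 2 * k - 1" and k: "k \<ge> 3" using assms unfolding k_def by presburger+
  note sigma = sigma_const_squared[OF m k]
  have "C_const m / sqrt (real n) * ((real m + 1) / 2) ^ n
      \<le> real (ap_free_max 3 (cyclic_power_group m n))" if n: "n \<ge> 1" for n
  proof -
    let ?A = "PiE {..<n} (\<lambda>_. {0..<int k})"
    let ?T = "\<lambda>x. \<Sum>i<n. digit_form k (x i)"
    let ?V = "real n * (sigma_const m)\<^sup>2"
    have cardA: "real (card ?A) = real k ^ n" by (simp add: card_PiE)
    have finA: "finite ?A" by (intro finite_PiE) auto
    have "(\<Sum>x\<in>?A. (real_of_int (?T x) - real n * digit_mean k)\<^sup>2)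
        = (\<Sum>x\<in>?A. (\<Sum>i<n. real_of_int (digit_form k (x i)) - digit_mean k)\<^sup>2)"
      by (simp add: sum_subtractf)
    also have "\<dots> = real (card {0..<int k}) ^ card {..<n} * (real (card {..<n}) * (sigma_const m)\<^sup>2)"
      by (rule sum_PiE_sum_squared)
         (simp_all add: digit_form_centered digit_form_variance sigma(1))
    also have "\<dots> = real (card ?A) * ?V" by (simp add: cardA)
    finally have var: "(\<Sum>x\<in>?A. (real_of_int (?T x) - real n * digit_mean k)\<^sup>2)
        \<le> real (card ?A) * ?V" by simp
    have "1 * (2 / 9) \<le> ?V" using n sigma(2) by (intro mult_mono) auto
    then obtain t where t: "real (card {x\<in>?A. ?T x = t}) \<ge> real (card ?A) / sqrt (27 * ?V)"
      using ex_large_fiber[OF finA var] by auto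
    \<comment> \<open>The factor 3 sqrt 3 of \<open>C_const\<close> is sqrt 27.\<close>
    have "sqrt (27 * ?V) = 3 * sqrt 3 * sigma_const m * sqrt (real n)"
      using sigma(3) real_sqrt_mult[of 9 3] by (simp add: real_sqrt_mult)
    then have "C_const m / sqrt (real n) * ((real m + 1) / 2) ^ n = real (card ?A) / sqrt (27 * ?V)"
      using k by (simp add: C_const_def cardA m of_nat_diff)
    also note t
    also have "card {x\<in>?A. ?T x = t} \<le> ap_free_max 3 (cyclic_power_group m n)"
    proof (rule card_le_ap_free_max)
      have carrier: "carrier (cyclic_power_group m n) = PiE {..<n} (\<lambda>_. {0..<int m})"
        using assms by (intro carrier_cyclic_power_group) simp
      show "finite (carrier (cyclic_power_group m n))"
        unfolding carrier by (intro finite_PiE) auto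
      have "?A \<subseteq> PiE {..<n} (\<lambda>_. {0..<int m})" using m k by (intro PiE_mono) auto
      then show "{x\<in>?A. ?T x = t} \<subseteq> carrier (cyclic_power_group m n)"
        unfolding carrier by blast
      show "\<not> contains_proper_ap (cyclic_power_group m n) 3 {x\<in>?A. ?T x = t}"
        using m k by (intro level_set_ap_free) auto
    qed
    finally show ?thesis by simp
  qed
  moreover have "C_const m > 0" using sigma(3) by (simp add: C_const_def)
  ultimately show ?thesis by (simp add: admissible_const_def)
qed

lemma C_const_asymp_equiv:
  "asymp_equiv C_const at_top (\<lambda>m. 8 * sqrt 5 / (sqrt 3 * real m ^ 2))"
proof -
  \<comment> \<open>Dividing 24 sqrt 5 by 3 sqrt 3 gives the limiting factor 8 sqrt 5 / sqrt
    3.\<close>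
  have 2880: "sqrt 2880 = 24 * sqrt 5" using real_sqrt_mult[of 576 5] by simp
  let ?p = "\<lambda>m. real m ^ 4 + 4 * real m ^ 3 - 14 * real m ^ 2 - 36 * real m + 45"
  have C: "C_const = (\<lambda>m. 8 * sqrt 5 / sqrt 3 * (1 / sqrt (?p m)))"
    by (rule ext) (simp add: C_const_def sigma_const_def real_sqrt_divide 2880)
  have "asymp_equiv (\<lambda>m. 1 / sqrt (?p m)) at_top (\<lambda>m. 1 / real m ^ 2)" by real_asymp
  then have "asymp_equiv C_const at_top (\<lambda>m. 8 * sqrt 5 / sqrt 3 * (1 / real m ^ 2))"
    unfolding C by (rule asymp_equiv_mult[OF asymp_equiv_refl])
  then show ?thesis by simp
qed

theorem theorem3p10:
  shows "(\<forall>m::nat. m \<ge> 5 \<and> odd m \<longrightarrow> (\<exists>C::real. admissible_const m C)) \<and>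
         (\<forall>m::nat. m \<ge> 5 \<and> odd m \<longrightarrow> admissible_const m (C_const m)) \<and>
         asymp_equiv C_const (inf at_top (principal {m::nat. odd m}))
           (\<lambda>m. 8 * sqrt 5 / (sqrt 3 * real m ^ 2))"
proof (intro conjI)
  show "asymp_equiv C_const (inf at_top (principal {m::nat. odd m}))
      (\<lambda>m. 8 * sqrt 5 / (sqrt 3 * real m ^ 2))"
    \<comment> \<open>The equivalence holds along all \<open>m\<close>, hence along the finer filter
      of odd \<open>m\<close>.\<close>
    using C_const_asymp_equiv unfolding asymp_equiv_def by (rule tendsto_mono[OF inf_le1])
qed (use admissible_C_const in blast)+

end
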